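(* Let $p>q>1$ be coprime integers. Then the subshift $\Xi_{p/q}\cap\Sigma_p^{\mathbb{Z}}$ is not sofic.
   Context: For $n\ge 2$ let $\Sigma_n=\{0,1,\dots,n-1\}$; note $\Sigma_p\subseteq\Sigma_{pq}$. For a finite alphabet $A$, $A^{\mathbb{Z}}$ carries the product topology, and $\sigma(x)[i]=x[i+1]$ is the shift map. A subshift is a nonempty closed $X\subseteq A^{\mathbb{Z}}$ with $\sigma(X)=X$. Its language $L(X)\subseteq A^*$ is the set of all finite words occurring as subwords $x[i]x[i+1]\cdots x[j]$ of elements $x\in X$ (including the empty word). A subshift $X$ is sofic if $L(X)$ is a regular language. For coprime integers $s,t>1$, write $a,b\in\Sigma_{st}$ uniquely as $a=a_1t+a_0$, $b=b_1t+b_0$ with $a_0,b_0\in\Sigma_t$, $a_1,b_1\in\Sigma_s$, and put $g_{s,st}(a,b)=a_0s+b_1$. Let $f_{s/t,st}(a,c,b)=g_{s,st}(g_{s,st}(a,c),g_{s,st}(c,b))$. The multiplication automaton $\Pi_{s/t,st}:\Sigma_{st}^{\mathbb{Z}}\to\Sigma_{st}^{\mathbb{Z}}$ is $\Pi_{s/t,st}(x)[i]=f_{s/t,st}(x[i-1],x[i],x[i+1])$; it is a bijection with inverse $\Pi_{t/s,st}$ and it multiplies by $s/t$ in base $st$. The trace of $x\in\Sigma_{st}^{\mathbb{Z}}$ is $\mathrm{Tr}_{s/t}(x)\in\Sigma_{st}^{\mathbb{Z}}$, $\mathrm{Tr}_{s/t}(x)[k]=\Pi_{s/t,st}^k(x)[0]$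 for $k\in\mathbb{Z}$, and the trace subshift is $\Xi_{s/t}=\mathrm{Tr}_{s/t}(\Sigma_{st}^{\mathbb{Z}})$. *)

theory Defs
  imports "HOL-Analysis.Function_Topology"
begin

abbreviation digits :: "nat \<Rightarrow> nat set" where
  "digits n \<equiv> {0..<n}"

definition full_shift :: "'a set \<Rightarrow> (int \<Rightarrow> 'a) set" where
  "full_shift A = UNIV \<rightarrow> A"

definition shift :: "(int \<Rightarrow> 'a) \<Rightarrow> (int \<Rightarrow> 'a)" where
  "shift x = (\<lambda>i. x (i + 1))"

text \<open>Being closed in the product topology includes being a subset of the full shift over \<open>A\<close>.\<close>

definition subshift :: "'a set \<Rightarrow> (int \<Rightarrow> 'a) set \<Rightarrow> bool" where
  "subshift A X \<longleftrightarrow>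
     finite A \<and> X \<noteq> {} \<and>
     closedin (product_topology (\<lambda>_. discrete_topology A) UNIV) X \<and>
     shift ` X = X"

text \<open>The list \<open>[i..j]\<close> is empty for \<open>j < i\<close>, which accounts for the empty word.\<close>

definition language :: "(int \<Rightarrow> 'a) set \<Rightarrow> 'a list set" where
  "language X = {map x [i..j] | x i j. x \<in> X}"

text \<open>Recognisability by a deterministic finite automaton; taking the states to be natural
  numbers is no restriction, since there are only finitely many of them.\<close>

definition regular_language :: "'a set \<Rightarrow> 'a list set \<Rightarrow> bool" where
  "regular_language A L \<longleftrightarrow>
     (\<exists>(Q :: nat set) \<delta> q0 F.
        finite Q \<and> q0 \<in> Q \<and> F \<subseteq> Q \<and> (\<forall>q\<in>Q. \<forall>a\<in>A. \<delta> q a \<in> Q) \<and>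
        L = {w \<in> lists A. foldl \<delta> q0 w \<in> F})"

definition sofic :: "'a set \<Rightarrow> (int \<Rightarrow> 'a) set \<Rightarrow> bool" where
  "sofic A X \<longleftrightarrow> subshift A X \<and> regular_language A (language X)"

text \<open>For a digit \<open>a = a\<^sub>1 * t + a\<^sub>0\<close> in base \<open>s * t\<close>, with \<open>a\<^sub>0 < t\<close> and \<open>a\<^sub>1 < s\<close>, one has
  \<open>a\<^sub>0 = a mod t\<close> and \<open>a\<^sub>1 = a div t\<close>.\<close>

definition mult_g :: "nat \<Rightarrow> nat \<Rightarrow> nat \<Rightarrow> nat \<Rightarrow> nat" where
  "mult_g s t a b = (a mod t) * s + b div t"

definition mult_f :: "nat \<Rightarrow> nat \<Rightarrow> nat \<Rightarrow> nat \<Rightarrow> nat \<Rightarrow> nat" where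
  "mult_f s t a c b = mult_g s t (mult_g s t a c) (mult_g s t c b)"

definition mult_automaton :: "nat \<Rightarrow> nat \<Rightarrow> (int \<Rightarrow> nat) \<Rightarrow> (int \<Rightarrow> nat)" where
  "mult_automaton s t x = (\<lambda>i. mult_f s t (x (i - 1)) (x i) (x (i + 1)))"

text \<open>Integer iterates of a bijection \<open>f\<close> of the set \<open>S\<close> onto itself.\<close>

definition int_iterate :: "'b set \<Rightarrow> ('b \<Rightarrow> 'b) \<Rightarrow> int \<Rightarrow> 'b \<Rightarrow> 'b" where
  "int_iterate S f k = (if 0 \<le> k then f ^^ nat k else inv_into S f ^^ nat (- k))"

definition config_trace :: "nat \<Rightarrow> nat \<Rightarrow> (int \<Rightarrow> nat) \<Rightarrow> (int \<Rightarrow> nat)" where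
  "config_trace s t x = (\<lambda>k. int_iterate (full_shift (digits (s * t))) (mult_automaton s t) k x 0)"

definition trace_subshift :: "nat \<Rightarrow> nat \<Rightarrow> (int \<Rightarrow> nat) set" where
  "trace_subshift s t = config_trace s t ` full_shift (digits (s * t))"

text \<open>The multiplication automaton is indeed a bijection, so that \<open>int_iterate\<close> is applied to it
  as intended.\<close>

lemma mult_g_less:
  assumes "a < s * t" "b < s * t"
  shows "mult_g s t a b < s * t"
proof -
  have t: "0 < t" using assms by (cases t) auto
  have "b div t < s" using assms by (simp add: less_mult_imp_div_less)
  moreover have "(a mod t + 1) * s \<le> t * s"
    using t by (intro mult_le_mono1) (simp add: Suc_leI)
  ultimately show ?thesis by (simp add: mult_g_def algebra_simps)
qed

lemma mult_g_inverse:
  assumes "b < s * t" "c < s * t"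
  shows "mult_g t s (mult_g s t a b) (mult_g s t b c) = b"
proof -
  have "b div t < s" "c div t < s"
    using assms by (simp_all add: less_mult_imp_div_less)
  then show ?thesis by (simp add: mult_g_def)
qed

lemma mult_automaton_in:
  "x \<in> full_shift (digits (s * t)) \<Longrightarrow> mult_automaton s t x \<in> full_shift (digits (s * t))"
  by (auto simp: full_shift_def mult_automaton_def mult_f_def Pi_iff intro!: mult_g_less)

lemma mult_automaton_inverse:
  assumes "x \<in> full_shift (digits (s * t))"
  shows "mult_automaton t s (mult_automaton s t x) = x"
proof -
  have x: "x i < s * t" for i using assms by (auto simp: full_shift_def Pi_iff)
  show ?thesis
    by (rule ext) (simp add: mult_automaton_def mult_f_def mult_g_inverse mult_g_less x)
qed

lemma bij_betw_mult_automaton: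
  "bij_betw (mult_automaton s t) (full_shift (digits (s * t))) (full_shift (digits (s * t)))"
  by (rule bij_betw_byWitness[where f' = "mult_automaton t s"])
     (use mult_automaton_inverse[of _ s t] mult_automaton_inverse[of _ t s]
          mult_automaton_in[of _ s t] mult_automaton_in[of _ t s] in \<open>auto simp: mult.commute\<close>)

end

theory Submission
  imports Defs "HOL-Analysis.T1_Spaces" "HOL-Number_Theory.Cong"
begin

text \<open>The column to the left of a column always exists and is unique, by the Chinese remainder
  theorem, whereas the columns to the right of column \<open>d\<close> amount to real numbers \<open>r k \<in> [0, 1]\<close>
  with \<open>p * (d k mod q + r k) = q * (d (k + 1) mod p + r (k + 1))\<close>. When all digits are below \<open>p\<close>,
  the numbers \<open>(d k mod q + r k) / q\<close> therefore form an orbit of the beta transformation for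
  \<open>\<beta> = p / q\<close>. As in Parry's theorem on beta shifts, a finite automaton would force the expansion
  of \<open>1\<close> to be eventually periodic. But the points of that expansion have strictly growing
  denominators, because \<open>p / q\<close> is not an integer. The expansions used here are left-continuous, with
  remainders in \<open>(0, 1]\<close>, so that the orbit can start at \<open>1\<close> itself.\<close>

section \<open>Integer iterates and space-time diagrams\<close>

lemma int_iterate_in:
  assumes "bij_betw f S S" "x \<in> S"
  shows "int_iterate S f k x \<in> S"
proof -
  have f: "f y \<in> S" if "y \<in> S" for y
    using assms(1) that by (auto simp: bij_betw_def)
  have g: "inv_into S f y \<in> S" if "y \<in> S" for y
    using assms(1) that by (metis bij_betw_def inv_into_into)
  have "(f ^^ n) x \<in> S" "(inv_into S f ^^ n) x \<in> S" for n
    by (induction n) (auto simp: assms(2) f g)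
  then show ?thesis by (simp add: int_iterate_def)
qed

lemma int_iterate_plus1:
  assumes "bij_betw f S S" "x \<in> S"
  shows "int_iterate S f (k + 1) x = f (int_iterate S f k x)"
proof (cases "0 \<le> k")
  case True
  then show ?thesis by (simp add: int_iterate_def nat_add_distrib)
next
  case False
  define n where "n = nat (- k - 1)"
  have k: "nat (- k) = Suc n" using False by (simp add: n_def)
  have step: "int_iterate S f (k + 1) x = (inv_into S f ^^ n) x"
    using False by (cases "k + 1 = 0") (simp_all add: int_iterate_def n_def)
  moreover have "(inv_into S f ^^ n) x \<in> S"
    using int_iterate_in[OF assms, of "k + 1"] step by simp
  moreover have "f ` S = S" using assms(1) by (simp add: bij_betw_def)
  ultimately show ?thesis
    using False by (simp add: int_iterate_def k f_inv_into_f)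
qed

text \<open>Forward in time the recurrence determines \<open>D\<close>; backward in time injectivity
  of \<open>f\<close> does.\<close>

lemma int_iterate_unique:
  assumes "bij_betw f S S" and D: "\<And>k. D k \<in> S" "\<And>k. D (k + 1) = f (D k)"
  shows "D k = int_iterate S f k (D 0)"
proof (induction k rule: int_induct[where k = 0])
  case base
  show ?case by (simp add: int_iterate_def)
next
  case (step1 k)
  then show ?case using int_iterate_plus1[OF assms(1) D(1)[of 0]] D(2) by simp
next
  case (step2 k)
  have "f (D (k - 1)) = f (int_iterate S f (k - 1) (D 0))"
    using step2 D(2)[of "k - 1"] int_iterate_plus1[OF assms(1) D(1)[of 0], of "k - 1"] by simp
  then show ?case
    using assms(1) D(1) int_iterate_in[OF assms(1) D(1)[of 0]]
    by (auto simp: bij_betw_def inj_on_def)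
qed

text \<open>An automaton step passes through an intermediate row, which is obtained from
  \<open>x\<close> by \<open>mult_g s t\<close> and, since \<open>mult_g t s\<close> undoes this,
  also from \<open>y\<close> by \<open>mult_g t s\<close>. Equating the two turns the step into a
  rule on two-by-two squares that treats both time directions alike.\<close>

lemma mult_automaton_eq_iff:
  assumes "\<And>i. x i < s * t" "\<And>i. y i < s * t"
  shows "y = mult_automaton s t x \<longleftrightarrow>
    (\<forall>i. mult_g s t (x i) (x (i + 1)) = mult_g t s (y i) (y (i + 1)))"
    (is "_ \<longleftrightarrow> ?rule")
proof
  assume "y = mult_automaton s t x"
  then show ?rule
    by (simp add: mult_automaton_def mult_f_def mult_g_inverse mult_g_less assms)
next
  assume rule: ?rule
  have "y i = mult_automaton s t x i" for i
    using rule[rule_format, of "i - 1"] rule[rule_format, of i] assms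
    by (simp add: mult_automaton_def mult_f_def mult_g_inverse mult.commute)
  then show "y = mult_automaton s t x" by auto
qed

text \<open>\<open>D\<close> is a space-time diagram, with time as first and position as second
  index. The local rule replaces the iterates and their inverses from here on, so a trace can be
  built column by column.\<close>

lemma trace_subshift_iff:
  "d \<in> trace_subshift s t \<longleftrightarrow>
    (\<exists>D :: int \<Rightarrow> int \<Rightarrow> nat. (\<forall>k i. D k i < s * t) \<and>
      (\<forall>k i. mult_g s t (D k i) (D k (i + 1)) = mult_g t s (D (k + 1) i) (D (k + 1) (i + 1))) \<and>
      d = (\<lambda>k. D k 0))" (is "_ \<longleftrightarrow> (\<exists>D. ?P D)")
proof
  let ?S = "full_shift (digits (s * t)) :: (int \<Rightarrow> nat) set"
  note bij = bij_betw_mult_automaton[of s t]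
  assume "d \<in> trace_subshift s t"
  then obtain x where x: "x \<in> ?S" "d = config_trace s t x"
    by (auto simp: trace_subshift_def)
  define D where "D = (\<lambda>k. int_iterate ?S (mult_automaton s t) k x)"
  have D: "D k i < s * t" for k i
    using int_iterate_in[OF bij x(1), of k] by (auto simp: D_def full_shift_def Pi_iff)
  have "D (k + 1) = mult_automaton s t (D k)" for k
    unfolding D_def by (rule int_iterate_plus1[OF bij x(1)])
  then have "mult_g s t (D k i) (D k (i + 1)) = mult_g t s (D (k + 1) i) (D (k + 1) (i + 1))" for k i
    using mult_automaton_eq_iff[of "D k" s t "D (k + 1)", OF D D] by blast
  moreover have "d = (\<lambda>k. D k 0)"
    using x(2) by (simp add: D_def config_trace_def)
  ultimately show "\<exists>D. ?P D" using D by blast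
next
  let ?S = "full_shift (digits (s * t)) :: (int \<Rightarrow> nat) set"
  assume "\<exists>D. ?P D"
  then obtain D where D: "?P D" ..
  have DS: "D k \<in> ?S" for k using D by (auto simp: full_shift_def)
  have step: "D (k + 1) = mult_automaton s t (D k)" for k
    using D mult_automaton_eq_iff[of "D k" s t "D (k + 1)"] by blast
  have "D k = int_iterate ?S (mult_automaton s t) k (D 0)" for k
    by (rule int_iterate_unique[where D = D, OF bij_betw_mult_automaton DS step])
  then have "config_trace s t (D 0) = (\<lambda>k. D k 0)"
    unfolding config_trace_def by metis
  then show "d \<in> trace_subshift s t"
    using D DS unfolding trace_subshift_def by (metis image_eqI)
qed

lemma shift_trace_subshift: "shift ` (trace_subshift s t \<inter> full_shift A) = trace_subshift s t \<inter> full_shift A"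
proof -
  \<comment> \<open>A diagram translated in time is again a diagram.\<close>
  have inv: "(\<lambda>k. d (k + c)) \<in> trace_subshift s t \<inter> full_shift A"
    if "d \<in> trace_subshift s t \<inter> full_shift A" for d and c :: int
  proof -
    have "d \<in> trace_subshift s t" using that by simp
    then obtain D :: "int \<Rightarrow> int \<Rightarrow> nat" where D: "\<forall>k i. D k i < s * t"
      "\<forall>k i. mult_g s t (D k i) (D k (i + 1)) = mult_g t s (D (k + 1) i) (D (k + 1) (i + 1))"
      "d = (\<lambda>k. D k 0)"
      unfolding trace_subshift_iff by (elim exE conjE)
    have "mult_g s t (D (k + c) i) (D (k + c) (i + 1)) = mult_g t s (D (k + 1 + c) i) (D (k + 1 + c) (i + 1))" for k i
      using D(2)[rule_format, of "k + c" i] by (simp add: add_ac)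
    then have "(\<lambda>k. d (k + c)) \<in> trace_subshift s t"
      unfolding trace_subshift_iff by (intro exI[of _ "\<lambda>k. D (k + c)"]) (simp add: D)
    then show ?thesis using that by (auto simp: full_shift_def)
  qed
  have "d \<in> shift ` (trace_subshift s t \<inter> full_shift A)"
    if "d \<in> trace_subshift s t \<inter> full_shift A" for d
    by (rule image_eqI[of _ _ "\<lambda>k. d (k + - 1)"]) (use inv[OF that, of "- 1"] in \<open>auto simp: shift_def\<close>)
  then show ?thesis using inv[of _ 1] by (auto simp: shift_def)
qed

section \<open>Closedness of the trace subshift, by compactness\<close>

lemma continuous_map_discrete_binary:
  assumes "continuous_map X (discrete_topology A) f" "continuous_map X (discrete_topology B) g"
    and "\<And>a b. a \<in> A \<Longrightarrow> b \<in> B \<Longrightarrow> h a b \<in> C"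
  shows "continuous_map X (discrete_topology C) (\<lambda>x. h (f x) (g x))"
proof -
  have "continuous_map X (discrete_topology (A \<times> B)) (\<lambda>x. (f x, g x))"
    using continuous_map_pairedI[OF assms(1,2)] by (simp add: prod_topology_discrete_topology)
  moreover have "continuous_map (discrete_topology (A \<times> B)) (discrete_topology C) (\<lambda>(a, b). h a b)"
    using assms(3) by auto
  ultimately have "continuous_map X (discrete_topology C) ((\<lambda>(a, b). h a b) \<circ> (\<lambda>x. (f x, g x)))"
    by (rule continuous_map_compose)
  then show ?thesis by (simp add: o_def)
qed

lemma continuous_map_mult_automaton:
  fixes s t
  defines "P \<equiv> product_topology (\<lambda>_::int. discrete_topology (digits (s * t))) UNIV"
  shows "continuous_map P P (mult_automaton s t)"
proof -
  have proj: "continuous_map P (discrete_topology (digits (s * t))) (\<lambda>x. x i)" for i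
    unfolding P_def by (rule continuous_map_product_projection) simp
  have g: "a \<in> digits (s * t) \<Longrightarrow> b \<in> digits (s * t) \<Longrightarrow> mult_g s t a b \<in> digits (s * t)" for a b
    by (simp add: mult_g_less)
  have "continuous_map P (discrete_topology (digits (s * t))) (\<lambda>x. mult_automaton s t x i)" for i
    unfolding mult_automaton_def mult_f_def
    by (intro continuous_map_discrete_binary[where h = "mult_g s t" and A = "digits (s * t)"
          and B = "digits (s * t)"] proj g)
  then show ?thesis
    unfolding P_def continuous_map_componentwise_UNIV by blast
qed

lemma continuous_map_config_trace:
  fixes s t
  defines "P \<equiv> product_topology (\<lambda>_::int. discrete_topology (digits (s * t))) UNIV"
  shows "continuous_map P P (config_trace s t)"
proof -
  let ?S = "full_shift (digits (s * t)) :: (int \<Rightarrow> nat) set"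
  have top: "topspace P = ?S" by (auto simp: P_def full_shift_def)
  have M: "continuous_map P P (mult_automaton s t)"
    unfolding P_def by (rule continuous_map_mult_automaton)
  \<comment> \<open>On the full shift the inverse is the automaton with the factors swapped, so the
    backward iterates are continuous for the same reason as the forward ones.\<close>
  have inv: "inv_into ?S (mult_automaton s t) x = mult_automaton t s x" if "x \<in> ?S" for x
  proof (rule inv_into_f_eq)
    show "inj_on (mult_automaton s t) ?S" by (rule bij_betw_imp_inj_on[OF bij_betw_mult_automaton])
    show "mult_automaton t s x \<in> ?S" "mult_automaton s t (mult_automaton t s x) = x"
      using mult_automaton_inverse[of x t s] mult_automaton_in[of x t s] that
      by (simp_all add: mult.commute[of t s])
  qed
  have I: "continuous_map P P (inv_into ?S (mult_automaton s t))"
  proof (rule continuous_map_eq)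
    show "continuous_map P P (mult_automaton t s)"
      using continuous_map_mult_automaton[of t s] by (simp add: P_def mult.commute[of t s])
  qed (simp add: inv top)
  have pow: "continuous_map P P (f ^^ n)" if "continuous_map P P f" for f n
    by (induction n) (use that in \<open>simp_all only: funpow.simps continuous_map_id continuous_map_compose\<close>)
  have "continuous_map P P (int_iterate ?S (mult_automaton s t) k)" for k
    unfolding int_iterate_def by (cases "0 \<le> k") (simp_all add: M I pow del: funpow.simps)
  then have "continuous_map P (discrete_topology (digits (s * t)))
      (\<lambda>x. int_iterate ?S (mult_automaton s t) k x 0)" for k
    unfolding P_def continuous_map_componentwise_UNIV by blast
  then show ?thesis
    unfolding P_def continuous_map_componentwise_UNIV config_trace_def by blast
qed

lemma closedin_trace_subshift:
  "closedin (product_topology (\<lambda>_. discrete_topology (digits (s * t))) UNIV) (trace_subshift s t)"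
proof -
  let ?P = "product_topology (\<lambda>_::int. discrete_topology (digits (s * t))) UNIV"
  have "compact_space ?P"
    by (simp add: compact_space_product_topology compact_space_discrete_topology)
  then have "compactin ?P (full_shift (digits (s * t)))"
    by (simp add: compact_space_def full_shift_def PiE_UNIV_domain)
  then have "compactin ?P (trace_subshift s t)"
    unfolding trace_subshift_def by (rule image_compactin[OF _ continuous_map_config_trace])
  then show ?thesis
    by (intro compactin_imp_closedin)
       (simp_all add: Hausdorff_space_product_topology Hausdorff_space_discrete_topology)
qed

lemma subshift_trace_subshift_Int:
  assumes "0 < n" "n \<le> s * t"
  shows "subshift (digits n) (trace_subshift s t \<inter> full_shift (digits n))"
proof -
  have "(\<lambda>_. 0) \<in> trace_subshift s t \<inter> full_shift (digits n)"
    unfolding trace_subshift_iff Int_iff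
    using assms less_le_trans[OF assms] by (intro conjI exI[of _ "\<lambda>_ _. 0"]) (auto simp: full_shift_def mult_g_def)
  \<comment> \<open>Closedness is known over the alphabet of size \<open>s * t\<close>. It passes to
    the smaller alphabet because the topology there is the subspace topology.\<close>
  moreover have "product_topology (\<lambda>_::int. discrete_topology (digits n)) UNIV
      = subtopology (product_topology (\<lambda>_. discrete_topology (digits (s * t))) UNIV)
          (full_shift (digits n))"
  proof -
    have "discrete_topology (digits n) = subtopology (discrete_topology (digits (s * t))) (digits n)"
      using assms by (simp add: subtopology_discrete_topology Int_absorb2 Int_absorb1)
    moreover have "full_shift (digits n) = (\<Pi>\<^sub>E i\<in>(UNIV :: int set). digits n)"
      by (simp add: full_shift_def PiE_UNIV_domain)
    ultimately show ?thesis
      by (simp only: subtopology_product_topology)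
  qed
  then have "closedin (product_topology (\<lambda>_. discrete_topology (digits n)) UNIV)
      (trace_subshift s t \<inter> full_shift (digits n))"
    using closedin_trace_subshift by (auto simp: closedin_subtopology)
  ultimately show ?thesis
    unfolding subshift_def using shift_trace_subshift[of s t] by auto
qed

section \<open>Extending columns to the left\<close>

text \<open>The rule at time \<open>k\<close> involves only \<open>c k mod t\<close> and
  \<open>c (k + 1) mod s\<close>, and it determines both. So \<open>c k\<close> has its residue
  modulo \<open>t\<close> from the rule at \<open>k\<close> and its residue modulo \<open>s\<close>
  from the rule at \<open>k - 1\<close>; coprimality lets them be combined.\<close>

lemma exists_left_column:
  fixes d :: "int \<Rightarrow> nat"
  assumes "coprime s t" "\<And>k. d k < s * t"
  shows "\<exists>c. (\<forall>k. c k < s * t) \<and>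
    (\<forall>k. mult_g s t (c k) (d k) = mult_g t s (c (k + 1)) (d (k + 1)))"
proof -
  have pos: "0 < s" "0 < t" using assms(2)[of 0] by (cases s; cases t; simp)+
  have "\<exists>r m. r < t \<and> m < s \<and> r * s + d k div t = m * t + d (k + 1) div s" for k
  proof -
    define a b where "a = d k div t" and "b = d (k + 1) div s"
    have ab: "a < s" "b < t"
      using assms(2) by (simp_all add: a_def b_def less_mult_imp_div_less mult.commute)
    obtain x where x: "[s * x = Suc 0] (mod t)"
      using cong_solve_coprime_nat[OF assms(1)] by blast
    \<comment> \<open>This solves \<open>r * s + a = b\<close> modulo \<open>t\<close>:
      \<open>x\<close> inverts \<open>s\<close>, and \<open>(t - 1) * a\<close> stands for
      \<open>- a\<close> in the naturals. The matching \<open>m\<close> is the quotient of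
      \<open>r * s + a\<close> by \<open>t\<close>.\<close>
    define r where "r = x * (b + (t - 1) * a) mod t"
    have "[r * s + a = x * (b + (t - 1) * a) * s + a] (mod t)"
      unfolding r_def by (intro cong_add cong_mult cong_refl) (simp add: cong_def)
    also have "x * (b + (t - 1) * a) * s + a = (s * x) * (b + (t - 1) * a) + a"
      by (simp add: algebra_simps)
    also have "[\<dots> = Suc 0 * (b + (t - 1) * a) + a] (mod t)"
      by (intro cong_add cong_mult cong_refl x)
    also have "Suc 0 * (b + (t - 1) * a) + a = b + t * a"
      using pos by (cases t) auto
    also have "[b + t * a = b] (mod t)" by (simp add: cong_def)
    finally have "(r * s + a) mod t = b" using ab by (simp add: cong_def)
    moreover have r: "r < t" using pos by (simp add: r_def)
    have "(r + 1) * s \<le> t * s" using r by (intro mult_le_mono1) simp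
    then have "(r * s + a) div t < s"
      using ab by (intro less_mult_imp_div_less) (simp add: algebra_simps)
    ultimately show ?thesis
      using r div_mult_mod_eq[of "r * s + a" t] unfolding a_def b_def by metis
  qed
  then obtain r m where rm: "\<And>k. r k < t" "\<And>k. m k < s"
    "\<And>k. r k * s + d k div t = m k * t + d (k + 1) div s"
    by metis
  have "\<exists>c. c < s * t \<and> c mod t = r k \<and> c mod s = m (k - 1)" for k
    using binary_chinese_remainder_unique_nat[OF assms(1), of "m (k - 1)" "r k"] pos rm
    by (auto simp: cong_def)
  then obtain c where c: "\<And>k. c k < s * t" "\<And>k. c k mod t = r k" "\<And>k. c k mod s = m (k - 1)"
    by metis
  have "mult_g s t (c k) (d k) = mult_g t s (c (k + 1)) (d (k + 1))" for k
    using rm(3)[of k] by (simp add: mult_g_def c)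
  then show ?thesis using c(1) by blast
qed

text \<open>Half a diagram suffices, as the columns at negative positions come from iterating the
  left extension. In \<open>E\<close> the column index comes first and time second.\<close>

lemma trace_subshift_columnsI:
  fixes E :: "nat \<Rightarrow> int \<Rightarrow> nat"
  assumes "coprime s t" and E: "\<And>i k. E i k < s * t"
    and rule: "\<And>i k. mult_g s t (E i k) (E (Suc i) k) = mult_g t s (E i (k + 1)) (E (Suc i) (k + 1))"
  shows "E 0 \<in> trace_subshift s t"
proof -
  have "\<exists>L. \<forall>d. (\<forall>k. d k < s * t) \<longrightarrow> (\<forall>k. L d k < s * t) \<and>
      (\<forall>k :: int. mult_g s t (L d k) (d k) = mult_g t s (L d (k + 1)) (d (k + 1)))"
    by (rule choice) (use exists_left_column[OF assms(1)] in blast)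
  then obtain L where L: "\<And>d k. (\<forall>k. d k < s * t) \<Longrightarrow> L d k < s * t"
    "\<And>d k :: int. (\<forall>k. d k < s * t) \<Longrightarrow>
      mult_g s t (L d k) (d k) = mult_g t s (L d (k + 1)) (d (k + 1))"
    by blast
  have Ln: "\<forall>k. (L ^^ n) (E 0) k < s * t" for n
    by (induction n) (use E L(1) in auto)
  define D where "D = (\<lambda>k i. if 0 \<le> i then E (nat i) k else (L ^^ nat (- i)) (E 0) k)"
  have "D k i < s * t" for k i
    using E Ln by (simp add: D_def)
  moreover have "mult_g s t (D k i) (D k (i + 1)) = mult_g t s (D (k + 1) i) (D (k + 1) (i + 1))" for k i
  proof (cases "0 \<le> i")
    case True
    then show ?thesis using rule by (simp add: D_def nat_add_distrib)
  next
    case False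
    define n where "n = nat (- i - 1)"
    have "nat (- i) = Suc n" using False by (simp add: n_def)
    then have "D k i = L ((L ^^ n) (E 0)) k" for k using False by (simp add: D_def)
    moreover have "D k (i + 1) = (L ^^ n) (E 0) k" for k
      using False by (cases "i = - 1") (simp_all add: D_def n_def)
    ultimately show ?thesis using L(2)[OF Ln[of n]] by simp
  qed
  moreover have "E 0 = (\<lambda>k. D k 0)" by (simp add: D_def)
  ultimately show ?thesis unfolding trace_subshift_iff by blast
qed

section \<open>From real orbits to traces\<close>

text \<open>\<open>\<lceil>y\<rceil> - 1\<close> is the largest integer strictly below
  \<open>y\<close>, so this is the units digit in the base \<open>b\<close> expansion whose
  fractional tail lies in (0, 1].\<close>

definition left_digit :: "nat \<Rightarrow> real \<Rightarrow> nat" where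
  "left_digit b y = nat ((\<lceil>y\<rceil> - 1) mod int b)"

text \<open>The counterpart of the nested floor identity for the largest integer strictly below a
  real number.\<close>

lemma ceiling_minus_one_div:
  assumes "0 < m"
  shows "(\<lceil>y :: real\<rceil> - 1) div int m = \<lceil>y / m\<rceil> - 1"
proof -
  define c where "c = \<lceil>y / m\<rceil> - 1"
  have "c < y / m" "y / m \<le> c + 1" unfolding c_def by linarith+
  then have "real_of_int (c * m) < y" "y \<le> real_of_int ((c + 1) * m)"
    using assms by (simp_all add: field_simps)
  then have "c * m < \<lceil>y\<rceil>" "\<lceil>y\<rceil> \<le> (c + 1) * m"
    by (simp_all only: less_ceiling_iff ceiling_le_iff)
  then show ?thesis
    unfolding c_def[symmetric]
    by (intro int_div_pos_eq[where r = "\<lceil>y\<rceil> - 1 - c * m"]) (simp_all add: algebra_simps)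
qed

text \<open>All three digits are read off the single integer \<open>N\<close>, since the largest
  integers below \<open>y * s\<close> and \<open>y\<close> are \<open>N div t\<close> and
  \<open>N div t div s\<close>. This shows that \<open>mult_g\<close> performs multiplication by
  \<open>s\<close> on expansions in base \<open>s * t\<close>.\<close>

lemma mult_g_left_digit:
  assumes "0 < s" "0 < t"
  shows "mult_g s t (left_digit (s * t) y) (left_digit (s * t) (y * (s * t))) = left_digit (s * t) (y * s)"
proof -
  define N where "N = \<lceil>y * (s * t)\<rceil> - 1"
  define M where "M = N div int t"
  have M: "\<lceil>y * s\<rceil> - 1 = M"
    using ceiling_minus_one_div[OF assms(2), of "y * (s * t)"] assms by (simp add: N_def M_def)
  have y: "\<lceil>y\<rceil> - 1 = M div int s"
    using ceiling_minus_one_div[OF assms(1), of "y * s"] assms by (simp add: M)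
  have N: "(N mod int (s * t)) div int t = M mod int s"
    using assms zmod_zmult2_eq[of "int s" N "int t"] by (simp add: M_def mult.commute[of s])
  have digit: "int (left_digit (s * t) z) = (\<lceil>z\<rceil> - 1) mod int (s * t)" for z
    using assms by (simp add: left_digit_def)
  have "int (mult_g s t (left_digit (s * t) y) (left_digit (s * t) (y * (s * t)))) =
      int (left_digit (s * t) y) mod int t * int s + int (left_digit (s * t) (y * (s * t))) div int t"
    by (simp add: mult_g_def zdiv_int zmod_int)
  also have "\<dots> = (M div int s mod int t) * int s + M mod int s"
    unfolding digit y N_def[symmetric] N by (simp add: mod_mod_cancel)
  also have "\<dots> = int (left_digit (s * t) (y * s))"
    unfolding digit M using zmod_zmult2_eq[of "int t" M "int s"] by (simp add: mult.commute)
  finally show ?thesis by linarith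
qed

lemma mod_diff_mult_self: "(a - c * b) mod b = a mod b" for a b c :: int
  using mod_mult_self1[of a "- c" b] by simp

lemma digits_of_orbit_in_trace_subshift:
  fixes x :: "int \<Rightarrow> real" and j :: "int \<Rightarrow> int"
  assumes "coprime p q" "0 < q" "\<And>k. 0 < x k" "\<And>k. x k \<le> p"
    and step: "\<And>k. x (k + 1) = p * (x k / q - j k)"
  shows "(\<lambda>k. nat (\<lceil>x k\<rceil> - 1)) \<in> trace_subshift p q \<inter> full_shift (digits p)"
proof -
  have p: "0 < p" using assms(3,4)[of 0] by linarith
  \<comment> \<open>Column \<open>i\<close> at time \<open>k\<close> holds the digit of
    \<open>x k\<close> at place \<open>i\<close> after the point, in base
    \<open>p * q\<close>.\<close>
  define E where "E = (\<lambda>i k. left_digit (p * q) (x k * (p * q) ^ i))"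
  have E: "E i k < p * q" for i k
    using p assms(2) by (simp add: E_def left_digit_def nat_less_iff)
  have "mult_g p q (E i k) (E (Suc i) k) = mult_g q p (E i (k + 1)) (E (Suc i) (k + 1))" for i k
  proof -
    have "mult_g p q (E i k) (E (Suc i) k) = left_digit (p * q) (x k * (p * q) ^ i * p)"
      using mult_g_left_digit[OF p assms(2), of "x k * (p * q) ^ i"]
      by (simp add: E_def mult_ac)
    moreover have "mult_g q p (E i (k + 1)) (E (Suc i) (k + 1)) =
        left_digit (p * q) (x (k + 1) * (p * q) ^ i * q)"
      using mult_g_left_digit[OF assms(2) p, of "x (k + 1) * (p * q) ^ i"]
      by (simp add: E_def mult_ac)
    \<comment> \<open>Up to the multiple \<open>j k * p * q\<close> of the base,
      \<open>x (k + 1) * q\<close> is \<open>x k * p\<close>. Scaling by powers of the base keeps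
      the difference such a multiple, so the digits on both sides of the rule agree.\<close>
    moreover have "x (k + 1) * q = x k * p - j k * p * q"
      using assms(2) by (simp add: step[of k] field_simps del: add.commute)
    then have "x (k + 1) * q * (p * q) ^ i = (x k * p - j k * p * q) * (p * q) ^ i"
      by simp
    then have "x (k + 1) * (p * q) ^ i * q =
        x k * (p * q) ^ i * p - real_of_int (j k * (p * q) ^ i * int (p * q))"
      by (simp add: algebra_simps)
    then have "\<lceil>x (k + 1) * (p * q) ^ i * q\<rceil> - 1 =
        (\<lceil>x k * (p * q) ^ i * p\<rceil> - 1) - j k * (p * q) ^ i * int (p * q)"
      by (simp only: ceiling_diff_of_int)
    then have "left_digit (p * q) (x (k + 1) * (p * q) ^ i * q) =
        left_digit (p * q) (x k * (p * q) ^ i * p)"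
      unfolding left_digit_def by (simp only: mod_diff_mult_self)
    ultimately show ?thesis by simp
  qed
  then have "E 0 \<in> trace_subshift p q"
    by (rule trace_subshift_columnsI[OF assms(1) E])
  moreover have digit: "0 \<le> \<lceil>x k\<rceil> - 1" "\<lceil>x k\<rceil> - 1 < int p" for k
    using assms(3,4)[of k] by linarith+
  moreover have "int p \<le> int p * int q" using assms(2) by (simp flip: of_nat_mult)
  then have "(\<lceil>x k\<rceil> - 1) mod int (p * q) = \<lceil>x k\<rceil> - 1" for k
    using digit[of k] by (simp only: of_nat_mult mod_pos_pos_trivial less_le_trans)
  then have "E 0 = (\<lambda>k. nat (\<lceil>x k\<rceil> - 1))"
    by (simp add: E_def left_digit_def)
  ultimately show ?thesis
    by (auto simp: full_shift_def nat_less_iff)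
qed

section \<open>From traces to real remainders\<close>

lemma base_digits_summable:
  fixes f :: "nat \<Rightarrow> nat"
  assumes "1 < b" "\<And>i. f i < b"
  shows "summable (\<lambda>i. f i / real b ^ Suc i)"
    and "0 \<le> (\<Sum>i. f i / real b ^ Suc i)" and "(\<Sum>i. f i / real b ^ Suc i) \<le> 1"
proof -
  have "(\<lambda>i. (1 / real b) ^ i) sums (1 / (1 - 1 / b))"
    using assms by (intro geometric_sums) simp
  from sums_mult[OF this, of "(b - 1) / b"]
  have g: "(\<lambda>i. (real b - 1) / real b ^ Suc i) sums 1"
    using assms by (simp add: field_simps)
  have le: "f i / real b ^ Suc i \<le> (real b - 1) / real b ^ Suc i" for i
    using assms(2)[of i] assms(1) by (intro divide_right_mono) auto
  show s: "summable (\<lambda>i. f i / real b ^ Suc i)"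
    by (rule summable_comparison_test'[OF sums_summable[OF g], of 0]) (use le in simp)
  show "0 \<le> (\<Sum>i. f i / real b ^ Suc i)" by (rule suminf_nonneg[OF s]) simp
  show "(\<Sum>i. f i / real b ^ Suc i) \<le> 1"
    using suminf_le[OF le s sums_summable[OF g]] sums_unique[OF g] by simp
qed

text \<open>Since the base is \<open>s * t\<close>, the high part of digit \<open>i + 1\<close> at
  weight \<open>i\<close> counts as \<open>s\<close> times its proper value at weight
  \<open>i + 1\<close>. There it rejoins the low part of the same digit. Only digit 0 loses its high
  part.\<close>

lemma suminf_mult_g:
  fixes f :: "nat \<Rightarrow> nat"
  assumes "1 < s * t" "\<And>i. f i < s * t"
  shows "(\<Sum>i. mult_g s t (f i) (f (Suc i)) / real (s * t) ^ i)
    = s * (f 0 mod t + (\<Sum>i. f (Suc i) / real (s * t) ^ Suc i))"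
proof -
  let ?b = "real (s * t)"
  define A where "A = (\<lambda>i. real (f i mod t) / ?b ^ i)"
  define B where "B = (\<lambda>i. real (t * (f (Suc i) div t)) / ?b ^ Suc i)"
  have pos: "0 < s" "0 < t" using assms(1) by (cases s; cases t; simp)+
  have mod: "f i mod t < s * t" for i
    using assms(2)[of i] mod_less_eq_dividend[of "f i" t] by linarith
  have "summable (\<lambda>i. ?b * (real (f i mod t) / ?b ^ Suc i))"
    by (intro summable_mult base_digits_summable(1) assms(1) mod)
  then have A: "summable A"
    using pos by (simp add: A_def)
  have "t * (f (Suc i) div t) < s * t" for i
    using assms(2)[of "Suc i"] times_div_less_eq_dividend[of t "f (Suc i)"] by linarith
  then have B: "summable B"
    unfolding B_def by (intro base_digits_summable(1) assms(1))
  have "(\<lambda>i. mult_g s t (f i) (f (Suc i)) / ?b ^ i) = (\<lambda>i. s * (A i + B i))"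
    using pos by (simp add: A_def B_def mult_g_def fun_eq_iff field_simps)
  then have "(\<Sum>i. mult_g s t (f i) (f (Suc i)) / ?b ^ i) = s * (suminf A + suminf B)"
    using A B by (simp add: suminf_mult suminf_add summable_add)
  also have "suminf A = A 0 + (\<Sum>i. A (Suc i))"
    using suminf_split_head[OF A] by simp
  also have "A 0 + (\<Sum>i. A (Suc i)) + suminf B = A 0 + (\<Sum>i. A (Suc i) + B i)"
    using A B by (simp add: suminf_add summable_Suc_iff)
  also have "(\<lambda>i. A (Suc i) + B i) = (\<lambda>i. f (Suc i) / ?b ^ Suc i)"
  proof
    fix i
    have "real (f (Suc i)) = real (f (Suc i) mod t) + real (t * (f (Suc i) div t))"
      by (metis mod_mult_div_eq of_nat_add)
    then show "A (Suc i) + B i = f (Suc i) / ?b ^ Suc i"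
      by (simp only: A_def B_def add_divide_distrib)
  qed
  finally show ?thesis by (simp add: A_def)
qed

lemma trace_subshift_remainders:
  fixes d :: "int \<Rightarrow> nat" and s t :: nat
  assumes "d \<in> trace_subshift s t" "1 < s * t"
  obtains r :: "int \<Rightarrow> real" where "\<And>k. 0 \<le> r k" "\<And>k. r k \<le> 1"
    "\<And>k. s * (d k mod t + r k) = t * (d (k + 1) mod s + r (k + 1))"
proof -
  obtain D :: "int \<Rightarrow> int \<Rightarrow> nat" where D: "\<forall>k i. D k i < s * t"
    "\<forall>k i. mult_g s t (D k i) (D k (i + 1)) = mult_g t s (D (k + 1) i) (D (k + 1) (i + 1))"
    "d = (\<lambda>k. D k 0)"
    using assms(1) unfolding trace_subshift_iff by (elim exE conjE)
  \<comment> \<open>The columns strictly to the right of the trace, read as a real number. Summing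
    the local rule over them, weighted by place, gives the recurrence.\<close>
  define r where "r = (\<lambda>k. \<Sum>i. D k (int (Suc i)) / real (s * t) ^ Suc i)"
  show thesis
  proof (rule that[of r])
    show "0 \<le> r k" "r k \<le> 1" for k
      unfolding r_def using D(1) assms(2)
      by (intro base_digits_summable[where f = "\<lambda>i. D k (int (Suc i))"]; simp)+
    show "s * (d k mod t + r k) = t * (d (k + 1) mod s + r (k + 1))" for k
    proof -
      have "s * (d k mod t + r k) = (\<Sum>i. mult_g s t (D k (int i)) (D k (int (Suc i))) / real (s * t) ^ i)"
        using suminf_mult_g[of s t "\<lambda>i. D k (int i)"] D assms(2) by (simp add: r_def)
      also have "\<dots> = (\<Sum>i. mult_g t s (D (k + 1) (int i)) (D (k + 1) (int (Suc i))) / real (t * s) ^ i)"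
        using D(2)[rule_format, of k "int _"] by (simp add: mult.commute[of t s] add.commute[of 1])
      also have "\<dots> = t * (d (k + 1) mod s + r (k + 1))"
        using suminf_mult_g[of t s "\<lambda>i. D (k + 1) (int i)"] D assms(2)
        by (simp add: r_def mult.commute)
      finally show ?thesis .
    qed
  qed
qed

section \<open>The expansion of one and its denominators\<close>

text \<open>The factor after \<open>p\<close> is the fractional part of \<open>y / q\<close>, taken
  in (0, 1]. Along an orbit these fractional parts follow the left-continuous beta transformation
  for \<open>p / q\<close>.\<close>

definition greedy_step :: "nat \<Rightarrow> nat \<Rightarrow> real \<Rightarrow> real" where
  "greedy_step p q y = p * (y / q - (\<lceil>y / q\<rceil> - 1))"

text \<open>Scaled by \<open>q\<close>, so that the point \<open>1\<close> becomes \<open>q\<close>; the negative indices carry a choice of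
  preimages, needed for a bi-infinite trace.\<close>

definition expansion_of_one :: "nat \<Rightarrow> nat \<Rightarrow> int \<Rightarrow> real" where
  "expansion_of_one p q k =
    (if 0 \<le> k then (greedy_step p q ^^ nat k) q else q * (q / p) ^ nat (- k))"

lemma expansion_of_one_step:
  assumes "0 < q" "q < p"
  shows "expansion_of_one p q (k + 1) = greedy_step p q (expansion_of_one p q k)"
proof (cases "0 \<le> k")
  case True
  then show ?thesis by (simp add: expansion_of_one_def nat_add_distrib)
next
  case False
  define n where "n = nat (- k - 1)"
  have "nat (- k) = Suc n" using False by (simp add: n_def)
  then have k: "expansion_of_one p q k = q * (q / p) ^ Suc n"
    using False by (simp add: expansion_of_one_def)
  \<comment> \<open>At negative times the value divided by \<open>q\<close> lies in (0, 1], so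
    nothing is subtracted and a step is multiplication by \<open>p / q\<close>.\<close>
  have "0 < (real q / p) ^ Suc n" "(real q / p) ^ Suc n \<le> 1"
    using assms by (simp_all add: power_le_one del: power_Suc)
  then have "\<lceil>(real q / p) ^ Suc n\<rceil> = 1" by linarith
  then have "greedy_step p q (expansion_of_one p q k) = q * (q / p) ^ n"
    unfolding greedy_step_def k using assms by simp
  also have "\<dots> = expansion_of_one p q (k + 1)"
    using False by (cases "k = - 1") (simp_all add: expansion_of_one_def n_def)
  finally show ?thesis by simp
qed

lemma expansion_of_one_bounds:
  assumes "0 < q" "q < p"
  shows "0 < expansion_of_one p q k" "expansion_of_one p q k \<le> p"
proof -
  have "0 < (greedy_step p q ^^ n) q \<and> (greedy_step p q ^^ n) q \<le> p" for n
  proof (induction n)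
    case (Suc n)
    have "0 < y / q - (\<lceil>y / q\<rceil> - 1)" "y / q - (\<lceil>y / q\<rceil> - 1) \<le> 1" for y :: real
      by linarith+
    then have "0 < greedy_step p q y" "greedy_step p q y \<le> p" for y
      using assms unfolding greedy_step_def
      by (simp_all add: mult_le_cancel_left1 del: of_int_diff)
    then show ?case by simp
  qed (use assms in simp)
  moreover have "0 < q * (real q / p) ^ n" "q * (real q / p) ^ n \<le> p" for n
  proof -
    have "q * (real q / p) ^ n \<le> real q * 1"
      using assms by (intro mult_left_mono power_le_one) auto
    also have "\<dots> \<le> p" using assms by simp
    finally show "q * (real q / p) ^ n \<le> p" .
  qed (use assms in simp)
  ultimately show "0 < expansion_of_one p q k" "expansion_of_one p q k \<le> p"
    by (simp_all add: expansion_of_one_def)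
qed

text \<open>The exact denominator is \<open>q ^ n\<close>: a step divides by \<open>q\<close>,
  changes the numerator by a multiple of \<open>q\<close>, and multiplies it by \<open>p\<close>,
  which is coprime to \<open>q\<close>. Counting starts at time 1 because the values
  \<open>q\<close> and \<open>p\<close> at times 0 and 1 are both integers.\<close>

lemma expansion_of_one_denominator:
  assumes "coprime p q" "1 < q" "q < p"
  shows "\<exists>a :: int. coprime a q \<and> expansion_of_one p q (int (Suc n)) * q ^ n = a"
proof (induction n)
  case 0
  have "expansion_of_one p q 0 = q" by (simp add: expansion_of_one_def)
  then have "expansion_of_one p q 1 = p"
    using expansion_of_one_step[of q p 0] assms by (simp add: greedy_step_def)
  then show ?case using assms(1) by (intro exI[of _ "int p"]) simp
next
  case (Suc n)
  define x where "x = expansion_of_one p q (int (Suc n))"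
  define j where "j = \<lceil>x / q\<rceil> - 1"
  obtain a :: int where a: "coprime a q" "x * real q ^ n = a" using Suc unfolding x_def by blast
  have Suc_Suc: "int (Suc (Suc n)) = int (Suc n) + 1" by simp
  have "expansion_of_one p q (int (Suc (Suc n))) = p * (x / q - j)"
    unfolding Suc_Suc using expansion_of_one_step[of q p "int (Suc n)"] assms
    by (simp add: greedy_step_def j_def x_def del: of_nat_Suc)
  moreover have "p * (x / q - j) * real q ^ Suc n = p * (x * real q ^ n - j * real q ^ Suc n)"
    using assms by (simp add: field_simps)
  ultimately have "expansion_of_one p q (int (Suc (Suc n))) * real q ^ Suc n
      = p * (x * real q ^ n - j * real q ^ Suc n)"
    by (simp only:)
  also have "\<dots> = real_of_int (int p * (a - j * int q ^ Suc n))"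
    unfolding a(2) by simp
  finally have "expansion_of_one p q (int (Suc (Suc n))) * real q ^ Suc n = real_of_int (int p * (a - j * int q ^ Suc n))" .
  moreover have "coprime (a - j * int q ^ Suc n) (int q)"
    using gcd_add_mult[of "int q" "- j * int q ^ n" a] a(1)
    by (simp add: coprime_iff_gcd_eq_1 gcd.commute algebra_simps)
  then have "coprime (int p * (a - j * int q ^ Suc n)) (int q)"
    using assms(1) by simp
  ultimately show ?case by blast
qed

text \<open>The denominators in lowest terms are distinct powers of \<open>q\<close>. This is what
  rules out eventual periodicity.\<close>

lemma inj_expansion_of_one:
  assumes "coprime p q" "1 < q" "q < p"
  shows "inj (\<lambda>n. expansion_of_one p q (int (Suc n)))"
proof (rule linorder_injI)
  fix m n :: nat
  assume "m < n"
  obtain a :: int where a: "expansion_of_one p q (int (Suc m)) * real q ^ m = a"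
    using expansion_of_one_denominator[OF assms, of m] by blast
  obtain b :: int where b: "coprime b q" "expansion_of_one p q (int (Suc n)) * real q ^ n = b"
    using expansion_of_one_denominator[OF assms, of n] by blast
  show "expansion_of_one p q (int (Suc m)) \<noteq> expansion_of_one p q (int (Suc n))"
  proof
    assume "expansion_of_one p q (int (Suc m)) = expansion_of_one p q (int (Suc n))"
    moreover have "real q ^ n = real q ^ m * real q ^ (n - m)"
      using \<open>m < n\<close> by (simp flip: power_add)
    ultimately have "real_of_int b = real_of_int (a * int q ^ (n - m))"
      by (simp add: mult.assoc flip: a b(2))
    then have "b = a * int q ^ (n - m)" by (simp only: of_int_eq_iff)
    then have "int q dvd b" using \<open>m < n\<close> by (simp add: dvd_power)
    then show False using b(1) assms(2) by (simp add: coprime_absorb_right)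
  qed
qed

section \<open>Non-regularity through an expanding gap\<close>

lemma orbit_gap:
  fixes x r :: "int \<Rightarrow> real" and d e :: "int \<Rightarrow> nat" and p q :: nat
  assumes x: "\<And>k. p * (d k mod q + (x k - d k)) = q * x (k + 1)"
    and r: "\<And>k. p * (e k mod q + r k) = q * (e (k + 1) + r (k + 1))"
    and "0 < q"
    and eq: "\<And>l. l < n \<Longrightarrow> e (i + int l) = d (j + int l)"
  shows "x (j + int n) - (e (i + int n) + r (i + int n)) = (p / q) ^ n * (x j - (e i + r i))"
  using eq
proof (induction n)
  case (Suc n)
  let ?g = "x (j + int n) - (e (i + int n) + r (i + int n))"
  have "q * (x (j + int (Suc n)) - (e (i + int (Suc n)) + r (i + int (Suc n)))) = p * ?g"
    using x[of "j + int n"] r[of "i + int n"] Suc.prems[of n]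
    by (simp add: algebra_simps)
  then have "x (j + int (Suc n)) - (e (i + int (Suc n)) + r (i + int (Suc n))) = p / q * ?g"
    using assms(3) by (simp add: field_simps)
  also have "?g = (p / q) ^ n * (x j - (e i + r i))" using Suc by simp
  finally show ?case by (simp only: power_Suc mult.assoc)
qed simp

text \<open>Two prefixes of the expansion of 1 reach the same state although the points following
  them differ. The continuation of the larger point is then accepted after the prefix of the smaller
  one. But that prefix bounds the next point from above, so the continuation starts with a positive
  gap, which expands beyond 1 while the digits still agree.\<close>

lemma not_regular_trace_subshift:
  assumes "coprime p q" "1 < q" "q < p"
  shows "\<not> regular_language (digits p) (language (trace_subshift p q \<inter> full_shift (digits p)))"
proof
  let ?X = "trace_subshift p q \<inter> full_shift (digits p)"
  assume "regular_language (digits p) (language ?X)"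
  then obtain Q :: "nat set" and \<delta> q0 F where Q: "finite Q" "q0 \<in> Q"
    "\<forall>s\<in>Q. \<forall>a\<in>digits p. \<delta> s a \<in> Q"
    and L: "language ?X = {w \<in> lists (digits p). foldl \<delta> q0 w \<in> F}"
    unfolding regular_language_def by blast
  define x where "x = expansion_of_one p q"
  define d where "d = (\<lambda>k. nat (\<lceil>x k\<rceil> - 1))"
  have q: "0 < q" using assms by simp
  have x0: "x 0 = q" by (simp add: x_def expansion_of_one_def)
  have x: "0 < x k" "x k \<le> p" for k
    unfolding x_def using expansion_of_one_bounds[OF q assms(3)] by auto
  have step: "x (k + 1) = p * (x k / q - real_of_int (\<lceil>x k / q\<rceil> - 1))" for k
    unfolding x_def using expansion_of_one_step[OF q assms(3), of k] by (simp add: greedy_step_def)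
  have "d \<in> ?X"
    unfolding d_def by (rule digits_of_orbit_in_trace_subshift[where x = x, OF assms(1) q x step])
  then have dp: "d k < p" for k by (auto simp: full_shift_def Pi_iff)
  have int_d: "int (d k) = \<lceil>x k\<rceil> - 1" for k
    using x(1)[of k] by (simp add: d_def)
  have d: "d k < x k" "x k \<le> d k + 1" for k
    using int_d[of k] by linarith+
  \<comment> \<open>The orbit obeys the same recurrence as a trace, with \<open>x k - d k\<close> as
    the remainder.\<close>
  have x_step: "p * (d k mod q + (x k - d k)) = q * x (k + 1)" for k
  proof -
    have "int (d k div q) = \<lceil>x k / q\<rceil> - 1"
      using ceiling_minus_one_div[OF q, of "x k"] by (simp add: int_d zdiv_int)
    moreover have "real (d k) = real (d k mod q) + q * real (d k div q)"
      by (metis mod_mult_div_eq of_nat_add of_nat_mult)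
    moreover have "real (d k div q) = real_of_int (int (d k div q))" by simp
    ultimately show ?thesis
      using q by (simp only: step) (simp add: field_simps)
  qed
  define w where "w = (\<lambda>n::nat. map d [0..int n])"
  have in_Q: "foldl \<delta> s u \<in> Q" if "s \<in> Q" "u \<in> lists (digits p)" for s u
    using that by (induction u arbitrary: s) (use Q(3) in auto)
  have "w n \<in> lists (digits p)" for n using dp by (auto simp: w_def)
  then have "range (\<lambda>n. foldl \<delta> q0 (w n)) \<subseteq> Q" using in_Q Q(2) by blast
  then have "\<not> inj (\<lambda>n. foldl \<delta> q0 (w n))"
    using Q(1) finite_imageD finite_subset infinite_UNIV_nat by blast
  then obtain m' n' where "m' \<noteq> n'" "foldl \<delta> q0 (w m') = foldl \<delta> q0 (w n')"
    by (auto simp: inj_def)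
  moreover have "x (int (Suc m')) \<noteq> x (int (Suc n'))"
    using inj_expansion_of_one[OF assms] \<open>m' \<noteq> n'\<close> unfolding x_def inj_def by blast
  \<comment> \<open>The two indices are named so that the prefix \<open>w n\<close> is followed by
    the smaller point.\<close>
  ultimately obtain m n where state: "foldl \<delta> q0 (w m) = foldl \<delta> q0 (w n)"
    and less: "x (int (Suc n)) < x (int (Suc m))"
    by (metis linorder_neq_iff)
  obtain t where t: "1 / (x (int (Suc m)) - x (int (Suc n))) < (real p / q) ^ t"
    using real_arch_pow[of "real p / q"] q assms(3) by auto
  \<comment> \<open>\<open>u\<close> has \<open>t + 1\<close> letters: \<open>t\<close> for the gap
    to grow, and one more so that the digits also agree at the time when the gap is compared with
    1.\<close>
  define u where "u = map d [int (Suc m)..int (Suc m + t)]"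
  have u: "u \<in> lists (digits p)" using dp by (auto simp: u_def)
  have "w m @ u = map d [0..int (Suc m + t)]"
    unfolding w_def u_def using upto_split1
    by (subst upto_split2[of 0 "int m" "int (Suc m + t)"]) (auto simp: add.commute)
  then have "w m @ u \<in> language ?X"
    using \<open>d \<in> ?X\<close> unfolding language_def by blast
  then have "w n @ u \<in> language ?X"
    using state \<open>\<And>n. w n \<in> lists (digits p)\<close> by (simp add: L)
  then obtain e a b where e: "e \<in> ?X" and word: "w n @ u = map e [a..b]"
    unfolding language_def by auto
  \<comment> \<open>Digits below \<open>p\<close> survive reduction modulo \<open>p\<close>; this
    brings the recurrence of the remainders into the form of a beta expansion.\<close>
  have ep: "e k mod p = e k" for k using e by (auto simp: full_shift_def Pi_iff)
  have len: "length [a..b] = Suc n + Suc t"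
    using arg_cong[OF word, of length] by (simp add: w_def u_def)
  have nth: "e (a + int l) = (w n @ u) ! l" if "l < Suc n + Suc t" for l
    using that len by (simp add: word nth_upto)
  have w_nth: "length (w n) = Suc n" "l < Suc n \<Longrightarrow> w n ! l = d (int l)" for l
    by (simp_all add: w_def nth_upto nat_add_distrib)
  have e_w: "e (a + int l) = d (0 + int l)" if "l < Suc n" for l
    using nth[of l] that by (simp add: nth_append w_nth)
  have e_u: "e (a + int (Suc n) + int l) = d (int (Suc m) + int l)" if "l < Suc t" for l
    using nth[of "Suc n + l"] that by (simp add: nth_append w_nth u_def nth_upto add_ac)
  obtain r :: "int \<Rightarrow> real" where r: "\<And>k. 0 \<le> r k" "\<And>k. r k \<le> 1"
    and "\<And>k. p * (e k mod q + r k) = q * (e (k + 1) mod p + r (k + 1))"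
  proof (rule trace_subshift_remainders)
    show "e \<in> trace_subshift p q" using e by simp
    show "1 < p * q" using assms by (intro less_1_mult) linarith+
  qed blast
  then have r_step: "p * (e k mod q + r k) = q * (e (k + 1) + r (k + 1))" for k
    by (simp add: ep)
  let ?y = "\<lambda>k. e k + r k"
  have "x (0 + int (Suc n)) - ?y (a + int (Suc n)) = (p / q) ^ Suc n * (x 0 - ?y a)"
    by (rule orbit_gap[where x = x and r = r and d = d and e = e, OF x_step r_step q]) (rule e_w)
  \<comment> \<open>The first digit is \<open>q - 1\<close> and the remainder is at most 1, so no
    trace beginning with this digit can start above \<open>x 0 = q\<close>. The sign of the gap
    persists along \<open>w n\<close>.\<close>
  moreover have "?y a \<le> x 0"
    using e_w[of 0] int_d[of 0] r(2)[of a] by (simp add: x0)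
  ultimately have "?y (a + int (Suc n)) \<le> x (int (Suc n))"
    by (metis add_0 diff_ge_0_iff_ge mult_nonneg_nonneg zero_le_power of_nat_0_le_iff divide_nonneg_nonneg)
  then have "(p / q) ^ t * (x (int (Suc m)) - x (int (Suc n)))
      \<le> (p / q) ^ t * (x (int (Suc m)) - ?y (a + int (Suc n)))"
    by (intro mult_left_mono) auto
  also have "\<dots> = x (int (Suc m) + int t) - ?y (a + int (Suc n) + int t)"
    by (rule orbit_gap[where x = x and r = r and d = d and e = e, OF x_step r_step q, symmetric]) (rule e_u, simp)
  \<comment> \<open>With equal digits the gap is a difference of remainders, \<open>x - d\<close>
    being at most 1 and \<open>r\<close> nonnegative.\<close>
  also have "\<dots> \<le> 1"
    using e_u[of t] d(2)[of "int (Suc m) + int t"] r(1)[of "a + int (Suc n) + int t"] by simp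
  finally show False
    using t less by (simp add: field_simps)
qed

theorem theorem3p18:
  fixes p q :: nat
  assumes "coprime p q" and "1 < q" and "q < p"
  shows "subshift (digits p) (trace_subshift p q \<inter> full_shift (digits p)) \<and>
         \<not> sofic (digits p) (trace_subshift p q \<inter> full_shift (digits p))"
  using subshift_trace_subshift_Int[of p p q] not_regular_trace_subshift[OF assms] assms
  by (simp add: sofic_def)

end
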